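(* Let $\Gamma$ be an inner ultrahomogeneous group such that for each $n\in\mathbf N$ there is an element of $\Gamma$ of finite order with at least $n$ distinct prime divisors. Then $\operatorname{Th}(\Gamma)$ is straightly maximal.
   Context: Conjugation is written $g^h=h^{-1}gh$. A finite partial automorphism of a group $G$ is an isomorphism between two finitely generated subgroups of $G$. A group $\Gamma$ is inner ultrahomogeneous if for every finite partial automorphism $p$ of $\Gamma$ there is some $g\in\Gamma$ such that $a^g=p(a)$ for all $a\in\operatorname{dom}p$. A complete theory $T$ is straightly maximal if there is a formula $\varphi(\bar x,\bar y)$ such that for every quantifier-free formula $\chi(z_1,\dots,z_n)$ in the language of Boolean algebras and every (equivalently, some) $M\models T$, there are $\bar b_1,\dots,\bar b_n$ in $M$ with $\mathcal P(M^{\bar x})\models\chi(\varphi(M,\bar b_1),\dots,\varphi(M,\bar b_n))$.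
   Formalization: In the definition of straightly maximal, the quantifier-free formulas χ are restricted to those satisfiable in some nontrivial Boolean algebra, since no theory can realise an inconsistent χ such as z ≠ z. *)

theory Defs
  imports "HOL-Algebra.Algebra"
begin

text \<open>First-order logic in the language of groups, with named variables.\<close>

datatype gterm =
    GVar nat
  | GOne
  | GMult gterm gterm
  | GInv gterm

datatype gform =
    GEq gterm gterm
  | GNot gform
  | GAnd gform gform
  | GEx nat gform

primrec gterm_vars :: "gterm \<Rightarrow> nat set" where
  "gterm_vars (GVar i) = {i}"
| "gterm_vars GOne = {}"
| "gterm_vars (GMult s t) = gterm_vars s \<union> gterm_vars t"
| "gterm_vars (GInv t) = gterm_vars t"

primrec free_vars :: "gform \<Rightarrow> nat set" where
  "free_vars (GEq s t) = gterm_vars s \<union> gterm_vars t"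
| "free_vars (GNot \<phi>) = free_vars \<phi>"
| "free_vars (GAnd \<phi> \<psi>) = free_vars \<phi> \<union> free_vars \<psi>"
| "free_vars (GEx i \<phi>) = free_vars \<phi> - {i}"

primrec gterm_val :: "'a monoid \<Rightarrow> (nat \<Rightarrow> 'a) \<Rightarrow> gterm \<Rightarrow> 'a" where
  "gterm_val M e (GVar i) = e i"
| "gterm_val M e GOne = \<one>\<^bsub>M\<^esub>"
| "gterm_val M e (GMult s t) = gterm_val M e s \<otimes>\<^bsub>M\<^esub> gterm_val M e t"
| "gterm_val M e (GInv t) = inv\<^bsub>M\<^esub> (gterm_val M e t)"

primrec gsat :: "'a monoid \<Rightarrow> (nat \<Rightarrow> 'a) \<Rightarrow> gform \<Rightarrow> bool" where
  "gsat M e (GEq s t) \<longleftrightarrow> gterm_val M e s = gterm_val M e t"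
| "gsat M e (GNot \<phi>) \<longleftrightarrow> \<not> gsat M e \<phi>"
| "gsat M e (GAnd \<phi> \<psi>) \<longleftrightarrow> gsat M e \<phi> \<and> gsat M e \<psi>"
| "gsat M e (GEx i \<phi>) \<longleftrightarrow> (\<exists>a\<in>carrier M. gsat M (e(i := a)) \<phi>)"

definition sentence :: "gform \<Rightarrow> bool" where
  "sentence \<sigma> \<longleftrightarrow> free_vars \<sigma> = {}"

definition holds :: "'a monoid \<Rightarrow> gform \<Rightarrow> bool" where
  "holds M \<sigma> \<longleftrightarrow> (\<forall>e. gsat M e \<sigma>)"

definition Th :: "'a monoid \<Rightarrow> gform set" where
  "Th M = {\<sigma>. sentence \<sigma> \<and> holds M \<sigma>}"

text \<open>
  Models are required to be groups, because the interpretation of \<^term>\<open>GInv\<close> is the inverse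
  derived from the multiplication. No model is lost this way for a theory that contains the group
  axioms, such as \<^term>\<open>Th M\<close> for a group \<^term>\<open>M\<close>.
\<close>

definition model_of :: "'a monoid \<Rightarrow> gform set \<Rightarrow> bool" where
  "model_of M T \<longleftrightarrow> group M \<and> (\<forall>\<sigma>\<in>T. holds M \<sigma>)"

definition tuples :: "'a monoid \<Rightarrow> nat \<Rightarrow> 'a list set" where
  "tuples M k = {as. length as = k \<and> set as \<subseteq> carrier M}"

text \<open>
  A formula \<open>\<phi>(x, y)\<close> with \<open>k = |x|\<close> and \<open>l = |y|\<close> has its free variables among \<open>0, \<dots>, k + l - 1\<close>:
  first those of \<open>x\<close>, then those of \<open>y\<close>. The set \<open>\<phi>(M, b)\<close> is \<open>def_set M k \<phi> b\<close>.
\<close>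

definition def_set :: "'a monoid \<Rightarrow> nat \<Rightarrow> gform \<Rightarrow> 'a list \<Rightarrow> 'a list set" where
  "def_set M k \<phi> bs = {as \<in> tuples M k. gsat M (\<lambda>i. (as @ bs) ! i) \<phi>}"

text \<open>
  Quantifier-free formulas in the language of Boolean algebras, evaluated in the power set
  \<open>Pow U\<close> of a set \<open>U\<close>.
\<close>

datatype bterm =
    BVar nat
  | BZero
  | BOne
  | BMeet bterm bterm
  | BJoin bterm bterm
  | BCompl bterm

datatype bform =
    BEq bterm bterm
  | BNot bform
  | BAnd bform bform
  | BOr bform bform

primrec bterm_vars :: "bterm \<Rightarrow> nat set" where
  "bterm_vars (BVar i) = {i}"
| "bterm_vars BZero = {}"
| "bterm_vars BOne = {}"
| "bterm_vars (BMeet s t) = bterm_vars s \<union> bterm_vars t"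
| "bterm_vars (BJoin s t) = bterm_vars s \<union> bterm_vars t"
| "bterm_vars (BCompl t) = bterm_vars t"

primrec bform_vars :: "bform \<Rightarrow> nat set" where
  "bform_vars (BEq s t) = bterm_vars s \<union> bterm_vars t"
| "bform_vars (BNot \<chi>) = bform_vars \<chi>"
| "bform_vars (BAnd \<chi> \<psi>) = bform_vars \<chi> \<union> bform_vars \<psi>"
| "bform_vars (BOr \<chi> \<psi>) = bform_vars \<chi> \<union> bform_vars \<psi>"

primrec bterm_val :: "'u set \<Rightarrow> (nat \<Rightarrow> 'u set) \<Rightarrow> bterm \<Rightarrow> 'u set" where
  "bterm_val U Z (BVar i) = Z i"
| "bterm_val U Z BZero = {}"
| "bterm_val U Z BOne = U"
| "bterm_val U Z (BMeet s t) = bterm_val U Z s \<inter> bterm_val U Z t"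
| "bterm_val U Z (BJoin s t) = bterm_val U Z s \<union> bterm_val U Z t"
| "bterm_val U Z (BCompl t) = U - bterm_val U Z t"

primrec bsat :: "'u set \<Rightarrow> (nat \<Rightarrow> 'u set) \<Rightarrow> bform \<Rightarrow> bool" where
  "bsat U Z (BEq s t) \<longleftrightarrow> bterm_val U Z s = bterm_val U Z t"
| "bsat U Z (BNot \<chi>) \<longleftrightarrow> \<not> bsat U Z \<chi>"
| "bsat U Z (BAnd \<chi> \<psi>) \<longleftrightarrow> bsat U Z \<chi> \<and> bsat U Z \<psi>"
| "bsat U Z (BOr \<chi> \<psi>) \<longleftrightarrow> bsat U Z \<chi> \<or> bsat U Z \<psi>"

text \<open>
  Consistency of a quantifier-free formula with the axioms of (nontrivial) Boolean algebras.
  Restricting to power sets of nonempty sets of natural numbers loses nothing: a witness in any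
  nontrivial Boolean algebra generates a finite subalgebra, which is isomorphic to the power set
  of its nonempty finite set of atoms.
\<close>

definition bconsistent :: "bform \<Rightarrow> bool" where
  "bconsistent \<chi> \<longleftrightarrow>
     (\<exists>(U :: nat set) Z. U \<noteq> {} \<and> (\<forall>i. Z i \<subseteq> U) \<and> bsat U Z \<chi>)"

text \<open>
  Straight maximality of a complete theory \<open>T\<close> of groups. The formulas \<open>\<chi>\<close> have to be restricted
  to the consistent ones: no theory realises \<open>z \<noteq> z\<close>.

  HOL cannot quantify over models of all types at once, so the type of the models is a parameter.
  For a given \<open>\<phi>\<close>, the required property of \<open>M\<close> is expressed by a set of first-order sentences,
  hence for complete \<open>T\<close> it has the same truth value in all models; a \<open>\<phi>\<close> that works for one type
  containing a model of \<open>T\<close> works for every type.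
\<close>

definition straightly_maximal :: "'m itself \<Rightarrow> gform set \<Rightarrow> bool" where
  "straightly_maximal TYPE('m) T \<longleftrightarrow>
     (\<exists>\<phi> k l. free_vars \<phi> \<subseteq> {..<k + l} \<and>
       (\<forall>n \<chi>. bform_vars \<chi> \<subseteq> {..<n} \<and> bconsistent \<chi> \<longrightarrow>
         (\<forall>M :: 'm monoid. model_of M T \<longrightarrow>
           (\<exists>b :: nat \<Rightarrow> 'm list.
              (\<forall>i<n. b i \<in> tuples M l) \<and>
              bsat (tuples M k) (\<lambda>i. def_set M k \<phi> (b i)) \<chi>))))"

definition fin_gen_subgroup :: "'a set \<Rightarrow> 'a monoid \<Rightarrow> bool" where
  "fin_gen_subgroup H G \<longleftrightarrow> (\<exists>S. finite S \<and> S \<subseteq> carrier G \<and> H = generate G S)"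

definition inner_ultrahomogeneous :: "'a monoid \<Rightarrow> bool" where
  "inner_ultrahomogeneous G \<longleftrightarrow>
     (\<forall>A B p. fin_gen_subgroup A G \<and> fin_gen_subgroup B G \<and>
              p \<in> iso (G\<lparr>carrier := A\<rparr>) (G\<lparr>carrier := B\<rparr>) \<longrightarrow>
        (\<exists>g\<in>carrier G. \<forall>a\<in>A. inv\<^bsub>G\<^esub> g \<otimes>\<^bsub>G\<^esub> a \<otimes>\<^bsub>G\<^esub> g = p a))"

end

theory Submission
  imports Defs "HOL-Number_Theory.Cong"
begin

text \<open>
  Let \<open>s\<close> be an element of finite odd order \<open>m\<close> and \<open>y\<close> an element of its bicommutant. Whenever
  \<open>s\<^sup>i y\<^sup>j = 1\<close> and \<open>s\<^sup>i y'\<^sup>j = 1\<close> are equivalent for some \<open>y'\<close> commuting with \<open>s\<close>, some \<open>g\<close> in the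
  centraliser of \<open>s\<close> conjugates \<open>y\<close> to \<open>y'\<close>, so \<open>y' = y\<close>. Taking for \<open>y'\<close> suitable powers of \<open>y\<close>
  shows that the order of \<open>y\<close> divides \<open>2 m\<close>. As elements of the same order are conjugate, \<open>x\<close> is
  conjugate to the square of an element of the bicommutant of \<open>s\<close> iff the order of \<open>x\<close> divides
  \<open>m\<close>; squaring removes the possible factor 2. Hence divisibility of orders, and then being of
  prime order dividing the order of \<open>u\<close>, is definable.

  To realise a finite nonempty set \<open>E\<close> of truth patterns, attach distinct odd primes \<open>p\<^sub>e\<close> to the
  patterns \<open>e \<in> E\<close>. Let \<open>u\<close> have order \<open>\<Prod>p\<^sub>e\<close>, and let \<open>s\<^sub>i\<close> have order the product of those \<open>p\<^sub>e\<close> for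
  which \<open>i\<close> is true in \<open>e\<close>. An element of order \<open>p\<^sub>e\<close> then sees the pattern \<open>e\<close>, and all elements
  not of prime order dividing the order of \<open>u\<close> are sent to one fixed pattern of \<open>E\<close>, which the
  parameters \<open>d\<^sub>i\<close> encode.
\<close>

section \<open>Units modulo \<open>n\<close> that are 1 modulo \<open>m\<close>\<close>

lemma exists_int_cong_1_coprime:
  fixes m n :: nat
  assumes "n > 0"
  shows "\<exists>v::int. [v = 1] (mod int m) \<and> coprime v (int n) \<and> coprime (v + 2 * int m) (int n)"
proof -
  \<comment> \<open>At primes dividing \<open>m\<close> the condition \<open>v = 1\<close> modulo
    \<open>m\<close> already gives coprimality. \<open>Q\<close> collects the remaining primes of
    \<open>n\<close>, where \<open>v\<close> can still be prescribed.\<close>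
  define Q where "Q = \<Prod>{q \<in> prime_factors n. \<not> q dvd m}"
  have "coprime m Q" unfolding Q_def
    by (rule prod_coprime_right) (auto simp: coprime_commute[of m] in_prime_factors_iff intro!: prime_imp_coprime)
  \<comment> \<open>\<open>v\<close> and \<open>v + 2m\<close> are \<open>-m\<close> and \<open>m\<close> modulo the primes that do not divide \<open>m\<close>.\<close>
  then obtain v :: int where v: "[v = 1] (mod int m)" "[v = - int m] (mod int Q)"
    using binary_chinese_remainder_int[of "int m" "int Q"] by auto
  have main: "\<not> int q dvd v \<and> \<not> int q dvd v + 2 * int m" if q: "Factorial_Ring.prime q" "q dvd n" for q :: nat
  proof (cases "q dvd m")
    case True
    then have "[v = 1] (mod int q)" using v(1) by (meson cong_dvd_modulus int_dvd_int_iff)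
    then have "int q dvd v - 1" by (simp add: cong_iff_dvd_diff)
    moreover have "\<not> int q dvd 1" using q by auto
    ultimately have "\<not> int q dvd v" using dvd_diff[of "int q" v "v - 1"] by auto
    moreover have "int q dvd 2 * int m" using True by simp
    ultimately show ?thesis using dvd_add_left_iff[of "int q" "2 * int m" v] by blast
  next
    case False
    have "q dvd Q" unfolding Q_def using q False assms
      by (intro dvd_prodI) (auto simp: in_prime_factors_iff)
    then have "[v = - int m] (mod int q)" using v(2) by (meson cong_dvd_modulus int_dvd_int_iff)
    then have *: "int q dvd v + int m" by (simp add: cong_iff_dvd_diff)
    have **: "\<not> int q dvd int m" using False by simp
    have "\<not> int q dvd v" using dvd_add_right_iff[of "int q" v "int m"] * ** by blast
    moreover have "\<not> int q dvd (v + int m) + int m" using dvd_add_right_iff[OF *] ** by blast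
    ultimately show ?thesis by (simp add: algebra_simps)
  qed
  have "coprime w (int n)" if "\<And>q. Factorial_Ring.prime q \<Longrightarrow> q dvd n \<Longrightarrow> \<not> int q dvd w" for w
  proof (rule ccontr)
    assume "\<not> coprime w (int n)"
    then have "\<not> coprime (nat \<bar>w\<bar>) n" by (simp flip: coprime_int_iff)
    then obtain q where q: "Factorial_Ring.prime q" "q dvd gcd (nat \<bar>w\<bar>) n"
      using prime_factor_nat by (metis coprime_iff_gcd_eq_1)
    have "q dvd nat \<bar>w\<bar>" "q dvd n" using dvd_trans[OF q(2)] gcd_dvd1 gcd_dvd2 by blast+
    then have "int q dvd w" by simp
    then show False using that[OF q(1) \<open>q dvd n\<close>] by blast
  qed
  then show ?thesis using v(1) main by blast
qed

text \<open>The two units \<open>v\<close> and \<open>v + 2 * m\<close> are both 1 modulo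
  \<open>n\<close>, so \<open>n\<close> divides their difference. Below, \<open>m = ord s\<close>,
  \<open>n = ord y\<close>, and \<open>k\<close> is an exponent with
  \<open>y [^] k = y\<close>.\<close>

lemma dvd_twice_of_units_cong_1:
  fixes m n :: nat
  assumes "n > 0"
    and "\<And>k::int. [k = 1] (mod int m) \<Longrightarrow> coprime k (int n) \<Longrightarrow> int n dvd k - 1"
  shows "n dvd 2 * m"
proof -
  obtain v :: int where v: "[v = 1] (mod int m)" "coprime v (int n)" "coprime (v + 2 * int m) (int n)"
    using exists_int_cong_1_coprime[OF assms(1)] by auto
  have "[v + 2 * int m = 1] (mod int m)" using v(1) by (simp add: cong_def)
  then have "int n dvd (v + 2 * int m - 1) - (v - 1)" using assms(2) v by (meson dvd_diff)
  then have "int n dvd int (2 * m)" by simp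
  then show ?thesis by (simp only: int_dvd_int_iff)
qed

subsection \<open>Definability of divisibility of orders\<close>

lemma (in group) int_pow_commute:
  assumes "x \<otimes> y = y \<otimes> x" "x \<in> carrier G" "y \<in> carrier G"
  shows "x [^] (i::int) \<otimes> y = y \<otimes> x [^] i"
proof (cases i rule: int_cases2)
  case (nonneg n)
  then show ?thesis using group_commutes_pow[OF assms] by (simp add: int_pow_int)
next
  case (nonpos n)
  have "x [^] n \<otimes> y = y \<otimes> x [^] n" using group_commutes_pow[OF assms] .
  then have "y \<otimes> inv (x [^] n) = inv (x [^] n) \<otimes> y"
  proof -
    have "x [^] n \<otimes> (y \<otimes> inv (x [^] n)) = (y \<otimes> x [^] n) \<otimes> inv (x [^] n)"
      using assms \<open>x [^] n \<otimes> y = y \<otimes> x [^] n\<close> by (simp flip: m_assoc)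
    also have "\<dots> = y" using assms by (simp add: m_assoc)
    finally show ?thesis using assms by (simp add: inv_solve_left)
  qed
  then show ?thesis using nonpos assms by (simp add: int_pow_neg_int)
qed

lemma (in group) int_pows_commute:
  assumes "x \<otimes> y = y \<otimes> x" "x \<in> carrier G" "y \<in> carrier G"
  shows "x [^] (i::int) \<otimes> y [^] (j::int) = y [^] j \<otimes> x [^] i"
  using int_pow_commute[of x y i] int_pow_commute[of y "x [^] i" j] assms by simp

context group
begin

lemma two_pow_mult:
  assumes "s \<otimes> h = h \<otimes> s" "s \<in> carrier G" "h \<in> carrier G"
  shows "(s [^] (i::int) \<otimes> h [^] (j::int)) \<otimes> (s [^] (i'::int) \<otimes> h [^] (j'::int))
     = s [^] (i + i') \<otimes> h [^] (j + j')"
proof -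
  have "(s [^] i \<otimes> h [^] j) \<otimes> (s [^] i' \<otimes> h [^] j')
      = s [^] i \<otimes> (h [^] j \<otimes> s [^] i') \<otimes> h [^] j'"
    using assms by (simp add: m_assoc)
  also have "h [^] j \<otimes> s [^] i' = s [^] i' \<otimes> h [^] j"
    using int_pows_commute[OF assms] by simp
  finally show ?thesis using assms by (simp add: m_assoc int_pow_mult)
qed

lemma two_pow_pow:
  assumes "s \<otimes> h = h \<otimes> s" "s \<in> carrier G" "h \<in> carrier G"
  shows "(s [^] (i::int) \<otimes> h [^] (j::int)) [^] (k::int) = s [^] (i * k) \<otimes> h [^] (j * k)"
  using int_pow_mult_distrib[OF int_pows_commute[OF assms]] assms by (simp add: int_pow_pow)

text \<open>Every coincidence of two words reduces to a relation with value 1, so the relations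
  alone determine the group generated by a commuting pair.\<close>

lemma two_pow_eq_iff:
  assumes "s \<otimes> h = h \<otimes> s" "s \<in> carrier G" "h \<in> carrier G"
  shows "s [^] (i::int) \<otimes> h [^] (j::int) = s [^] (i'::int) \<otimes> h [^] (j'::int)
     \<longleftrightarrow> s [^] (i - i') \<otimes> h [^] (j - j') = \<one>"
proof -
  have *: "s [^] i \<otimes> h [^] j = (s [^] (i - i') \<otimes> h [^] (j - j')) \<otimes> (s [^] i' \<otimes> h [^] j')"
    by (simp add: two_pow_mult[OF assms])
  show ?thesis using assms by (subst *) simp
qed

lemma generate_commuting_pair:
  assumes "s \<otimes> h = h \<otimes> s" "s \<in> carrier G" "h \<in> carrier G"
  shows "generate G {s, h} = {s [^] i \<otimes> h [^] j | (i::int) (j::int). True}" (is "_ = ?E")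
proof (rule generateI[symmetric])
  show "subgroup ?E G"
  proof
    show "?E \<subseteq> carrier G" using assms by (auto intro!: m_closed int_pow_closed)
    show "\<one> \<in> ?E" using assms by (intro CollectI exI[of _ "0::int"]) simp
    fix x assume "x \<in> ?E"
    then obtain i j :: int where x: "x = s [^] i \<otimes> h [^] j" by auto
    have "inv x = s [^] (- i) \<otimes> h [^] (- j)"
    proof -
      have "inv x = x [^] (-1::int)" using assms x by (simp add: int_pow_neg)
      then show ?thesis unfolding x by (simp add: two_pow_pow[OF assms])
    qed
    then show "inv x \<in> ?E" by blast
    fix y assume "y \<in> ?E"
    then show "x \<otimes> y \<in> ?E" unfolding x using two_pow_mult[OF assms] by blast
  qed
  have "s = s [^] (1::int) \<otimes> h [^] (0::int)" "h = s [^] (0::int) \<otimes> h [^] (1::int)"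
    using assms by simp_all
  then show "{s, h} \<subseteq> ?E" by blast
  fix K assume K: "subgroup K G" "{s, h} \<subseteq> K"
  then show "?E \<subseteq> K"
    by (auto intro!: subgroup.m_closed simp: subgroup_int_pow_closed)
qed

end

section \<open>Conjugacy in inner ultrahomogeneous groups\<close>

locale inner_ultrahomogeneous_group = group G for G :: "'a monoid" (structure) +
  assumes homogeneous: "inner_ultrahomogeneous G"
begin

text \<open>Equal relations yield an isomorphism of the generated subgroups that fixes
  \<open>s\<close> and sends \<open>h\<close> to \<open>h'\<close>. Homogeneity realises it by
  conjugation, and the conjugating element centralises \<open>s\<close> because \<open>s\<close> is
  fixed.\<close>

lemma conjugate_commuting_pair:
  assumes s: "s \<in> carrier G"
    and h: "h \<in> carrier G" "s \<otimes> h = h \<otimes> s"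
    and h': "h' \<in> carrier G" "s \<otimes> h' = h' \<otimes> s"
    and rel: "\<And>(i::int) (j::int). s [^] i \<otimes> h [^] j = \<one> \<longleftrightarrow> s [^] i \<otimes> h' [^] j = \<one>"
  shows "\<exists>g\<in>carrier G. s \<otimes> g = g \<otimes> s \<and> h \<otimes> g = g \<otimes> h'"
proof -
  let ?A = "generate G {s, h}" and ?B = "generate G {s, h'}"
  note A = generate_commuting_pair[OF h(2) s h(1)]
  note B = generate_commuting_pair[OF h'(2) s h'(1)]
  note E = two_pow_eq_iff[OF h(2) s h(1)] and E' = two_pow_eq_iff[OF h'(2) s h'(1)]
  note M = two_pow_mult[OF h(2) s h(1)] and M' = two_pow_mult[OF h'(2) s h'(1)]
  \<comment> \<open>The image is read off any pair of exponents representing \<open>a\<close>;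
    \<open>rel\<close> makes it independent of the pair.\<close>
  define p where "p a = (SOME b. \<exists>(i::int) (j::int). a = s [^] i \<otimes> h [^] j \<and> b = s [^] i \<otimes> h' [^] j)" for a
  have p: "p (s [^] i \<otimes> h [^] j) = s [^] i \<otimes> h' [^] j" for i j :: int
    unfolding p_def
  proof (rule some_equality)
    fix b assume "\<exists>(i'::int) (j'::int). s [^] i \<otimes> h [^] j = s [^] i' \<otimes> h [^] j' \<and> b = s [^] i' \<otimes> h' [^] j'"
    then obtain i' j' :: int where "s [^] i \<otimes> h [^] j = s [^] i' \<otimes> h [^] j'"
      and b: "b = s [^] i' \<otimes> h' [^] j'" by blast
    then have "s [^] (i - i') \<otimes> h' [^] (j - j') = \<one>" using E rel by simp
    then show "b = s [^] i \<otimes> h' [^] j" unfolding b by (simp only: E'[symmetric])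
  qed blast
  have "p \<in> iso (G\<lparr>carrier := ?A\<rparr>) (G\<lparr>carrier := ?B\<rparr>)"
  proof (rule isoI)
    show "p \<in> hom (G\<lparr>carrier := ?A\<rparr>) (G\<lparr>carrier := ?B\<rparr>)"
    proof (rule homI)
      fix a assume "a \<in> carrier (G\<lparr>carrier := ?A\<rparr>)"
      then obtain i j :: int where "a = s [^] i \<otimes> h [^] j" by (auto simp: A)
      then show "p a \<in> carrier (G\<lparr>carrier := ?B\<rparr>)" using p[of i j] by (simp add: B) blast
    next
      fix a b assume "a \<in> carrier (G\<lparr>carrier := ?A\<rparr>)" "b \<in> carrier (G\<lparr>carrier := ?A\<rparr>)"
      then obtain i j i' j' :: int where "a = s [^] i \<otimes> h [^] j" "b = s [^] i' \<otimes> h [^] j'"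
        by (auto simp: A)
      then show "p (a \<otimes>\<^bsub>G\<lparr>carrier := ?A\<rparr>\<^esub> b) = p a \<otimes>\<^bsub>G\<lparr>carrier := ?B\<rparr>\<^esub> p b"
        by (simp add: p M M')
    qed
    \<comment> \<open>Here \<open>rel\<close> is used in the other direction.\<close>
    have "inj_on p ?A" unfolding A
      by (rule inj_onI) (auto simp: p E E' rel)
    moreover have "p ` ?A = ?B"
      unfolding A B
    proof (intro equalityI subsetI)
      fix b assume "b \<in> {s [^] i \<otimes> h' [^] j | (i::int) (j::int). True}"
      then obtain i j :: int where "b = p (s [^] i \<otimes> h [^] j)" by (auto simp: p)
      then show "b \<in> p ` {s [^] i \<otimes> h [^] j | (i::int) (j::int). True}" by blast
    next
      fix b assume "b \<in> p ` {s [^] i \<otimes> h [^] j | (i::int) (j::int). True}"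
      then obtain i j :: int where "b = s [^] i \<otimes> h' [^] j" using p by blast
      then show "b \<in> {s [^] i \<otimes> h' [^] j | (i::int) (j::int). True}" by blast
    qed
    ultimately show "bij_betw p (carrier (G\<lparr>carrier := ?A\<rparr>)) (carrier (G\<lparr>carrier := ?B\<rparr>))"
      by (simp add: bij_betw_def)
  qed
  moreover have "fin_gen_subgroup ?A G" "fin_gen_subgroup ?B G"
    unfolding fin_gen_subgroup_def using s h h'
    by (auto intro: exI[of _ "{s, h}"] exI[of _ "{s, h'}"])
  ultimately obtain g where g: "g \<in> carrier G" "\<forall>a\<in>?A. inv g \<otimes> a \<otimes> g = p a"
    using homogeneous unfolding inner_ultrahomogeneous_def by meson
  have conj: "a \<otimes> g = g \<otimes> p a" if "a \<in> ?A" for a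
  proof -
    have "a \<in> carrier G" using that generate_incl[of "{s, h}"] s h by auto
    then have "g \<otimes> (inv g \<otimes> a \<otimes> g) = a \<otimes> g" using g by (simp add: m_assoc[symmetric])
    then show ?thesis using g that by simp
  qed
  have "s \<in> ?A" "h \<in> ?A" by (simp_all add: generate.incl)
  moreover have "p s = s" using p[of 1 0] s h h' by simp
  moreover have "p h = h'" using p[of 0 1] s h h' by simp
  ultimately have "s \<otimes> g = g \<otimes> s" "h \<otimes> g = g \<otimes> h'" using conj[of s] conj[of h] by simp_all
  then show ?thesis using g by blast
qed

lemma conjugate_of_same_ord:
  assumes "x \<in> carrier G" "y \<in> carrier G" "ord x = ord y"
  shows "\<exists>g\<in>carrier G. x \<otimes> g = g \<otimes> y"
proof -
  \<comment> \<open>With the identity in the role of \<open>s\<close>, the relations say that the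
    order divides \<open>j\<close>. This covers infinite order too, where \<open>ord\<close> is
    0.\<close>
  have "\<one> [^] i \<otimes> x [^] j = \<one> \<longleftrightarrow> \<one> [^] i \<otimes> y [^] j = \<one>" for i j :: int
    using assms by (simp add: int_pow_eq_id)
  then show ?thesis using conjugate_commuting_pair[OF one_closed, of x y] assms by auto
qed

end

text \<open>A first-order condition on \<open>x\<close> and \<open>s\<close>. Its reading as
  divisibility of orders is justified by \<open>ord_divides_iff\<close> in inner ultrahomogeneous
  groups, for \<open>s\<close> of odd order.\<close>

definition ord_divides :: "'a monoid \<Rightarrow> 'a \<Rightarrow> 'a \<Rightarrow> bool" where
  "ord_divides G x s \<longleftrightarrow> (\<exists>g\<in>carrier G. \<exists>y\<in>carrier G. x \<otimes>\<^bsub>G\<^esub> g = g \<otimes>\<^bsub>G\<^esub> (y \<otimes>\<^bsub>G\<^esub> y) \<and>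
     (\<forall>c\<in>carrier G. c \<otimes>\<^bsub>G\<^esub> s = s \<otimes>\<^bsub>G\<^esub> c \<longrightarrow> c \<otimes>\<^bsub>G\<^esub> y = y \<otimes>\<^bsub>G\<^esub> c))"

context inner_ultrahomogeneous_group
begin

lemma bicommutant_ord_dvd:
  assumes s: "s \<in> carrier G" "ord s > 0"
    and y: "y \<in> carrier G" and cc: "\<And>c. c \<in> carrier G \<Longrightarrow> c \<otimes> s = s \<otimes> c \<Longrightarrow> c \<otimes> y = y \<otimes> c"
  shows "ord y dvd 2 * ord s"
proof -
  have sy: "s \<otimes> y = y \<otimes> s" using cc[OF s(1)] s by simp
  \<comment> \<open>The conjugating element centralises \<open>s\<close>, hence commutes with
    \<open>y\<close>, so conjugation by it cannot move \<open>y\<close>.\<close>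
  have fixed: "y [^] k = y" if rel: "\<And>(i::int) (j::int). s [^] i \<otimes> y [^] j = \<one> \<longleftrightarrow> s [^] i \<otimes> (y [^] k) [^] j = \<one>" for k :: int
  proof -
    have "s \<otimes> y [^] k = y [^] k \<otimes> s" using int_pow_commute[OF sy[symmetric]] s y by simp
    then obtain g where g: "g \<in> carrier G" "s \<otimes> g = g \<otimes> s" "y \<otimes> g = g \<otimes> y [^] k"
      using conjugate_commuting_pair[OF s(1) y sy int_pow_closed[OF y] _ rel] by blast
    then have "g \<otimes> y = g \<otimes> y [^] k" using cc[of g] by simp
    then show ?thesis using g y by simp
  qed
  have "ord y > 0"
  proof (rule ccontr)
    assume o0: "\<not> ord y > 0"
    then have pe: "y [^] j = \<one> \<longleftrightarrow> j = 0" for j :: int using int_pow_eq_id[OF y] by simp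
    \<comment> \<open>Raising to the power \<open>ord s\<close> removes \<open>s\<close> and leaves
      a power of \<open>y\<close>, which has infinite order here.\<close>
    have z: "j = 0" if "s [^] i \<otimes> y [^] j = \<one>" for i j :: int
    proof -
      have "(s [^] i \<otimes> y [^] j) [^] int (ord s) = \<one>" using that by simp
      then have "s [^] (i * int (ord s)) \<otimes> y [^] (j * int (ord s)) = \<one>"
        by (simp only: two_pow_pow[OF sy s(1) y])
      moreover have "s [^] (i * int (ord s)) = \<one>" using s by (simp add: int_pow_eq_id)
      ultimately have "j * int (ord s) = 0" using y pe by simp
      then show "j = 0" using s(2) by simp
    qed
    \<comment> \<open>All relations have \<open>j = 0\<close>, so \<open>y\<close> and its inverse
      satisfy the same ones. But \<open>y\<close> equal to its inverse contradicts infinite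
      order.\<close>
    have "y [^] (-1::int) = y"
    proof (rule fixed)
      fix i j :: int
      have "(y [^] (-1::int)) [^] j = y [^] (-j)" using y by (simp only: int_pow_pow) simp
      then show "s [^] i \<otimes> y [^] j = \<one> \<longleftrightarrow> s [^] i \<otimes> (y [^] (-1::int)) [^] j = \<one>"
        using z[of i j] z[of i "-j"] by auto
    qed
    then have "y [^] (-1::int) = y [^] (1::int)" using y by simp
    then show False using int_pow_eq[OF y] o0 by simp
  qed
  moreover have "int (ord y) dvd k - 1" if k: "[k = 1] (mod int (ord s))" "coprime k (int (ord y))" for k :: int
  proof -
    have "int (ord s) dvd k - 1" using k(1) by (simp add: cong_iff_dvd_diff)
    have sk: "s [^] (i * k) = s [^] i" for i :: int
    proof -
      have "int (ord s) dvd i * (k - 1)" using \<open>int (ord s) dvd k - 1\<close> by simp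
      then have "int (ord s) dvd i * k - i" by (simp add: algebra_simps)
      then show ?thesis using int_pow_eq[OF s(1)] by (simp add: dvd_diff_commute)
    qed
    have cs: "coprime k (int (ord s))"
      using cong_imp_coprime[OF cong_sym[OF k(1)]] by simp
    have "y [^] k = y"
    proof (rule fixed)
      fix i j :: int
      \<comment> \<open>Since \<open>k\<close> is 1 modulo \<open>ord s\<close>, the word in
        \<open>s\<close> and \<open>y [^] k\<close> is the \<open>k\<close>-th power of
        \<open>?w\<close>. The order of \<open>?w\<close> is prime to \<open>k\<close>, so
        \<open>?w\<close> and its \<open>k\<close>-th power are trivial together.\<close>
      let ?w = "s [^] i \<otimes> y [^] j"
      have w: "?w \<in> carrier G" using s y by simp
      have wk: "?w [^] k = s [^] i \<otimes> (y [^] k) [^] j"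
        by (simp only: two_pow_pow[OF sy s(1) y] sk int_pow_pow[OF y] mult.commute[of k j])
      have "?w [^] (int (ord s) * int (ord y)) = \<one>"
      proof -
        have "s [^] (i * (int (ord s) * int (ord y))) = \<one>" "y [^] (j * (int (ord s) * int (ord y))) = \<one>"
          using s y by (simp_all add: int_pow_eq_id)
        then show ?thesis by (simp add: two_pow_pow[OF sy s(1) y])
      qed
      then have "int (ord ?w) dvd int (ord s) * int (ord y)" by (simp only: int_pow_eq_id[OF w])
      moreover have "coprime (int (ord s) * int (ord y)) k" using cs k(2) by (simp add: coprime_commute)
      ultimately have cw: "coprime (int (ord ?w)) k" by (rule coprime_divisors[OF _ dvd_refl])
      have "int (ord ?w) dvd k \<longleftrightarrow> ord ?w = 1"
      proof
        assume "int (ord ?w) dvd k"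
        from coprime_absorb_left[OF this] cw have "is_unit (int (ord ?w))" by (rule iffD1)
        then show "ord ?w = 1" by simp
      qed simp
      then have "?w [^] k = \<one> \<longleftrightarrow> ?w = \<one>" by (simp only: int_pow_eq_id[OF w] ord_eq_1[OF w])
      then show "?w = \<one> \<longleftrightarrow> s [^] i \<otimes> (y [^] k) [^] j = \<one>" using wk by simp
    qed
    then have "y [^] k = y [^] (1::int)" using y by simp
    then show ?thesis using int_pow_eq[OF y] by (simp add: dvd_diff_commute)
  qed
  ultimately show ?thesis by (rule dvd_twice_of_units_cong_1)
qed

lemma ord_divides_iff:
  assumes s: "s \<in> carrier G" "odd (ord s)" and x: "x \<in> carrier G"
  shows "ord_divides G x s \<longleftrightarrow> ord x dvd ord s"
proof
  assume "ord_divides G x s"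
  then obtain g y where g: "g \<in> carrier G" and y: "y \<in> carrier G" and xg: "x \<otimes> g = g \<otimes> (y \<otimes> y)"
    and cc: "\<And>c. c \<in> carrier G \<Longrightarrow> c \<otimes> s = s \<otimes> c \<Longrightarrow> c \<otimes> y = y \<otimes> c"
    unfolding ord_divides_def by blast
  have "ord y dvd 2 * ord s" using bicommutant_ord_dvd[OF s(1) odd_pos[OF s(2)] y cc] .
  then have "y [^] (2 * ord s) = \<one>" using y by (simp add: pow_eq_id)
  moreover have "y \<otimes> y = y [^] (2::nat)" using y by (simp add: numeral_2_eq_2)
  ultimately have yy: "(y \<otimes> y) [^] ord s = \<one>" using y by (simp add: nat_pow_pow)
  \<comment> \<open>Conjugation respects powers, so \<open>x\<close> inherits the exponent
    \<open>ord s\<close> from \<open>y \<otimes> y\<close>.\<close>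
  have "x [^] n \<otimes> g = g \<otimes> (y \<otimes> y) [^] n" for n :: nat
  proof (induction n)
    case (Suc n)
    have "x [^] Suc n \<otimes> g = x [^] n \<otimes> (x \<otimes> g)" using x g by (simp add: m_assoc)
    also have "\<dots> = (x [^] n \<otimes> g) \<otimes> (y \<otimes> y)" unfolding xg using x g y by (simp add: m_assoc)
    also have "\<dots> = g \<otimes> (y \<otimes> y) [^] Suc n" unfolding Suc using g y by (simp add: m_assoc)
    finally show ?case .
  qed (use g in simp)
  then have "x [^] ord s \<otimes> g = g" using yy g by simp
  then have "x [^] ord s = \<one>" using x g by simp
  then show "ord x dvd ord s" using x by (simp add: pow_eq_id)
next
  assume d: "ord x dvd ord s"
  \<comment> \<open>A power of \<open>s\<close> with the order of \<open>x\<close>, hence conjugate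
    to \<open>x\<close>.\<close>
  let ?z = "s [^] (ord s div ord x)"
  have oz: "ord ?z = ord x"
    using d s odd_pos[OF s(2)] by (subst ord_pow) (auto simp: dvd_div_eq_0_iff elim!: dvdE)
  then obtain g where g: "g \<in> carrier G" "x \<otimes> g = g \<otimes> ?z"
    using conjugate_of_same_ord[OF x, of ?z] s by auto
  \<comment> \<open>The square root of \<open>?z\<close>: the exponent is half of
    \<open>ord s + 1\<close>, an even number, and \<open>?z\<close> to the power
    \<open>ord s\<close> is trivial. As a power of \<open>s\<close> it lies in the
    bicommutant.\<close>
  let ?y = "?z [^] (Suc (ord s) div 2)"
  have "Suc (ord s) div 2 + Suc (ord s) div 2 = Suc (ord s)" using s(2) by presburger
  then have "?y \<otimes> ?y = ?z [^] Suc (ord s)"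
    using s by (simp only: nat_pow_mult nat_pow_closed)
  also have "\<dots> = ?z" using s d oz by (simp add: pow_eq_id)
  finally have yy: "?y \<otimes> ?y = ?z" .
  have comm: "c \<otimes> ?y = ?y \<otimes> c" if "c \<in> carrier G" "c \<otimes> s = s \<otimes> c" for c
  proof -
    have "?z \<otimes> c = c \<otimes> ?z" using group_commutes_pow[OF that(2)[symmetric] s(1) that(1)] .
    from group_commutes_pow[OF this nat_pow_closed[OF s(1)] that(1)] show ?thesis by (rule sym)
  qed
  show "ord_divides G x s"
    unfolding ord_divides_def
  proof (intro bexI conjI ballI impI)
    show "x \<otimes> g = g \<otimes> (?y \<otimes> ?y)" unfolding yy by (rule g(2))
  qed (rule comm g(1) nat_pow_closed s(1); assumption?)+
qed

end

subsection \<open>Coding finite sets of patterns\<close>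

text \<open>Primality expressed by divisibility of orders alone. Quantifying over elements reaches
  every divisor of a finite order, by \<open>exists_ord_eq_divisor\<close>.\<close>

definition prime_divides :: "'a monoid \<Rightarrow> 'a \<Rightarrow> 'a \<Rightarrow> bool" where
  "prime_divides G x u \<longleftrightarrow> ord_divides G x u \<and> x \<noteq> \<one>\<^bsub>G\<^esub> \<and>
     (\<forall>x'\<in>carrier G. ord_divides G x' x \<longrightarrow> x' = \<one>\<^bsub>G\<^esub> \<or> ord_divides G x x')"

text \<open>The last branch ignores \<open>x\<close>, so all elements it applies to see one common
  pattern, given by which \<open>d\<close> are trivial.\<close>

definition coded :: "'a monoid \<Rightarrow> 'a \<Rightarrow> 'a \<Rightarrow> 'a \<Rightarrow> 'a \<Rightarrow> bool" where
  "coded G x u s d \<longleftrightarrow> (if prime_divides G x u then ord_divides G x s else d = \<one>\<^bsub>G\<^esub>)"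

lemma (in group) exists_ord_eq_divisor:
  assumes w: "w \<in> carrier G" "ord w > 0" and k: "k dvd ord w"
  shows "\<exists>x\<in>carrier G. ord x = k"
proof -
  obtain c where c: "ord w = k * c" using k by (rule dvdE)
  then have "ord (w [^] c) = k" using w by (subst ord_pow) auto
  then show ?thesis using w(1) by (intro bexI[of _ "w [^] c"]) auto
qed

context inner_ultrahomogeneous_group
begin

lemma prime_divides_iff:
  assumes u: "u \<in> carrier G" "odd (ord u)" and x: "x \<in> carrier G"
  shows "prime_divides G x u \<longleftrightarrow> Factorial_Ring.prime (ord x) \<and> ord x dvd ord u"
proof (cases "ord x dvd ord u \<and> x \<noteq> \<one>")
  case True
  \<comment> \<open>Oddness passes from \<open>ord u\<close> to \<open>ord x\<close> and its
    divisors, so \<open>ord_divides_iff\<close> applies to every nested use of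
    \<open>ord_divides\<close>.\<close>
  then have odd_x: "odd (ord x)" using u(2) dvd_trans by blast
  then have pos: "ord x > 0" by (rule odd_pos)
  have ne1: "ord x \<noteq> 1" using ord_eq_1[OF x] True by blast
  have "prime_divides G x u \<longleftrightarrow>
      (\<forall>x'\<in>carrier G. ord x' dvd ord x \<longrightarrow> ord x' = 1 \<or> ord x dvd ord x')"
  proof -
    have "x' = \<one> \<or> ord_divides G x x' \<longleftrightarrow> ord x' = 1 \<or> ord x dvd ord x'"
      if x': "x' \<in> carrier G" and "ord x' dvd ord x" for x'
    proof -
      have "odd (ord x')" using odd_x that(2) dvd_trans by blast
      then show ?thesis using ord_divides_iff[OF x' _ x] ord_eq_1[OF x'] by blast
    qed
    then show ?thesis unfolding prime_divides_def
      using True ord_divides_iff[OF u x] ord_divides_iff[OF x odd_x] by blast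
  qed
  also have "\<dots> \<longleftrightarrow> Factorial_Ring.prime (ord x)"
  proof
    assume *: "\<forall>x'\<in>carrier G. ord x' dvd ord x \<longrightarrow> ord x' = 1 \<or> ord x dvd ord x'"
    obtain q where q: "Factorial_Ring.prime q" "q dvd ord x" using prime_factor_nat[OF ne1] by blast
    obtain x' where "x' \<in> carrier G" "ord x' = q" using exists_ord_eq_divisor[OF x pos q(2)] by blast
    then have "ord x dvd q" using * q by auto
    then have "ord x = q" using q(2) by (rule dvd_antisym)
    then show "Factorial_Ring.prime (ord x)" using q(1) by simp
  next
    assume "Factorial_Ring.prime (ord x)"
    then show "\<forall>x'\<in>carrier G. ord x' dvd ord x \<longrightarrow> ord x' = 1 \<or> ord x dvd ord x'"
      using prime_nat_iff by auto
  qed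
  finally show ?thesis using True by blast
next
  case False
  have "\<not> Factorial_Ring.prime (ord x)" if "x = \<one>" using that by simp
  then show ?thesis using False ord_divides_iff[OF u x] unfolding prime_divides_def by blast
qed

lemma exists_coding:
  fixes E :: "nat set set"
  assumes many: "\<And>n. \<exists>g\<in>carrier G. ord g > 0 \<and> card (prime_factors (ord g)) \<ge> n"
    and E: "finite E" "E \<noteq> {}"
  shows "\<exists>u s d. u \<in> carrier G \<and> (\<forall>i. s i \<in> carrier G \<and> d i \<in> carrier G) \<and>
     (\<lambda>x. {i. coded G x u (s i) (d i)}) ` carrier G = E"
proof -
  \<comment> \<open>One prime more than there are patterns, since 2 is discarded to keep all orders
    odd.\<close>
  obtain w where w: "w \<in> carrier G" "ord w > 0" "card (prime_factors (ord w)) \<ge> Suc (card E)"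
    using many by blast
  let ?P = "prime_factors (ord w) - {2}"
  have "card E \<le> card ?P" using w(3) by (auto simp: card_Diff_singleton_if)
  then obtain pr where pr: "inj_on pr E" "pr ` E \<subseteq> ?P"
    using card_le_inj[OF E(1), of ?P] by auto
  define N where "N F = \<Prod>(pr ` F)" for F
  have prp: "Factorial_Ring.prime (pr e)" "odd (pr e)" if "e \<in> E" for e
  proof -
    have "pr e \<in> ?P" using pr(2) that by blast
    then show "Factorial_Ring.prime (pr e)" and "odd (pr e)"
      using primes_dvd_imp_eq[of 2 "pr e"] by auto
  qed
  have pr_dvd_pr: "pr e dvd pr f \<longleftrightarrow> e = f" if "e \<in> E" "f \<in> E" for e f
    using primes_dvd_imp_eq[OF prp(1) prp(1), of e f] inj_onD[OF pr(1), of e f] that by auto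
  have N_dvd: "N F dvd ord w" if "F \<subseteq> E" for F
  proof -
    have "N F dvd \<Prod>(prime_factors (ord w))"
      unfolding N_def using pr(2) that by (intro prod_dvd_prod_subset) auto
    also have "\<dots> dvd (\<Prod>p\<in>prime_factors (ord w). p ^ multiplicity p (ord w))"
      by (intro prod_dvd_prod dvd_power) (auto simp: prime_factors_multiplicity)
    also have "\<dots> = ord w" using prime_factorization_nat[OF w(2)] by (rule sym)
    finally show ?thesis .
  qed
  have N_odd: "odd (N F)" if "F \<subseteq> E" for F
  proof -
    have "finite (pr ` F)" using that E(1) finite_subset by blast
    then show ?thesis unfolding N_def using that prp(2) by (simp add: even_prod_iff subset_iff)
  qed
  have dvd_N: "pr e dvd N F \<longleftrightarrow> e \<in> F" if "F \<subseteq> E" "e \<in> E" for e F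
  proof -
    have fin: "finite (pr ` F)" using that E(1) finite_subset by blast
    have "pr e dvd N F \<longleftrightarrow> (\<exists>f\<in>F. pr e dvd pr f)"
      unfolding N_def using prime_dvd_prod_iff[OF fin prp(1)[OF that(2)], of "\<lambda>x. x"] by simp
    also have "\<dots> \<longleftrightarrow> e \<in> F" using pr_dvd_pr[OF that(2)] that(1) by (auto simp: subset_iff)
    finally show ?thesis .
  qed
  define el where "el k = (SOME x. x \<in> carrier G \<and> ord x = k)" for k
  have el: "el k \<in> carrier G" "ord (el k) = k" if "k dvd ord w" for k
  proof -
    have "\<exists>x. x \<in> carrier G \<and> ord x = k" using exists_ord_eq_divisor[OF w(1,2) that] by blast
    then have "el k \<in> carrier G \<and> ord (el k) = k" unfolding el_def by (rule someI_ex)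
    then show "el k \<in> carrier G" "ord (el k) = k" by blast+
  qed
  \<comment> \<open>The default pattern must belong to \<open>E\<close>, because the realised
    patterns have to be exactly \<open>E\<close>.\<close>
  obtain e0 where e0: "e0 \<in> E" using E(2) by blast
  have "w \<noteq> \<one>"
  proof
    assume "w = \<one>"
    then have "ord w = 1" by simp
    then show False using w(3) by simp
  qed
  define u where "u = el (N E)"
  define s where "s i = el (N {e \<in> E. i \<in> e})" for i
  \<comment> \<open>Only triviality of \<open>d i\<close> matters; \<open>w\<close> serves as a
    nontrivial element.\<close>
  define d where "d i = (if i \<in> e0 then \<one> else w)" for i
  have u: "u \<in> carrier G" "ord u = N E" unfolding u_def using el N_dvd by auto
  have s: "s i \<in> carrier G" "ord (s i) = N {e \<in> E. i \<in> e}" for i unfolding s_def using el N_dvd by auto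
  have prime_case: "{i. coded G x u (s i) (d i)} = e"
    if x: "x \<in> carrier G" "e \<in> E" "ord x = pr e" for x e
  proof -
    have "odd (ord u)" using N_odd u by simp
    then have "prime_divides G x u" using prime_divides_iff[OF u(1) _ x(1)] prp x u dvd_N by simp
    moreover have "ord_divides G x (s i) \<longleftrightarrow> i \<in> e" for i
      using ord_divides_iff[OF s(1) _ x(1)] N_odd[of "{e \<in> E. i \<in> e}"] dvd_N[of "{e \<in> E. i \<in> e}" e] s x
      by simp
    ultimately show ?thesis unfolding coded_def by simp
  qed
  have other_case: "{i. coded G x u (s i) (d i)} = e0" if "\<not> prime_divides G x u" for x
    using that \<open>w \<noteq> \<one>\<close> unfolding coded_def d_def by simp
  have "(\<lambda>x. {i. coded G x u (s i) (d i)}) ` carrier G = E"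
  proof (intro equalityI subsetI)
    fix e assume "e \<in> (\<lambda>x. {i. coded G x u (s i) (d i)}) ` carrier G"
    then obtain x where x: "x \<in> carrier G" "e = {i. coded G x u (s i) (d i)}" by blast
    show "e \<in> E"
    proof (cases "prime_divides G x u")
      case True
      moreover have "odd (ord u)" using N_odd u(2) by simp
      ultimately have o: "Factorial_Ring.prime (ord x)" "ord x dvd \<Prod>(pr ` E)"
        using prime_divides_iff[OF u(1) _ x(1)] u(2) unfolding N_def by simp_all
      have "\<exists>q\<in>pr ` E. ord x dvd q"
        using o(2) prime_dvd_prod_iff[OF finite_imageI[OF E(1)] o(1), of "\<lambda>x. x"] by blast
      then obtain f where f: "f \<in> E" "ord x dvd pr f" by blast
      have "ord x = pr f" using primes_dvd_imp_eq[OF o(1) prp(1)[OF f(1)] f(2)] .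
      then show ?thesis using prime_case[OF x(1) f(1)] x(2) f(1) by simp
    next
      case False
      then show ?thesis using other_case[OF False] x(2) e0 by simp
    qed
  next
    fix e assume e: "e \<in> E"
    then have "pr e \<in> prime_factors (ord w)" using pr(2) by blast
    then have dvd: "pr e dvd ord w" by auto
    show "e \<in> (\<lambda>x. {i. coded G x u (s i) (d i)}) ` carrier G"
      by (rule image_eqI[OF _ el(1)[OF dvd]], rule prime_case[symmetric, OF el(1)[OF dvd] e el(2)[OF dvd]])
  qed
  moreover have "d i \<in> carrier G" for i unfolding d_def using w by simp
  ultimately show ?thesis using u(1) s(1) by (intro exI[of _ u] exI[of _ s] exI[of _ d]) simp
qed

end

subsection \<open>Defining formulas and the transfer to other models\<close>

text \<open>In the following formulas, \<open>k\<close> is a bound on the free variables; the bound variables are \<open>\<ge> k\<close>.\<close>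

definition ord_divides_form :: "nat \<Rightarrow> nat \<Rightarrow> nat \<Rightarrow> gform" where
  "ord_divides_form x s k = GEx k (GEx (k + 1) (GAnd
     (GEq (GMult (GVar x) (GVar k)) (GMult (GVar k) (GMult (GVar (k + 1)) (GVar (k + 1)))))
     (GNot (GEx (k + 2) (GAnd
        (GEq (GMult (GVar (k + 2)) (GVar s)) (GMult (GVar s) (GVar (k + 2))))
        (GNot (GEq (GMult (GVar (k + 2)) (GVar (k + 1))) (GMult (GVar (k + 1)) (GVar (k + 2))))))))))"

definition prime_divides_form :: "nat \<Rightarrow> nat \<Rightarrow> nat \<Rightarrow> gform" where
  "prime_divides_form x u k = GAnd (ord_divides_form x u k) (GAnd (GNot (GEq (GVar x) GOne))
     (GNot (GEx k (GAnd (ord_divides_form k x (k + 1))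
        (GAnd (GNot (GEq (GVar k) GOne)) (GNot (ord_divides_form x k (k + 1))))))))"

definition coded_form :: "nat \<Rightarrow> nat \<Rightarrow> nat \<Rightarrow> nat \<Rightarrow> nat \<Rightarrow> gform" where
  "coded_form x u s d k = GNot (GAnd
     (GNot (GAnd (prime_divides_form x u k) (ord_divides_form x s k)))
     (GNot (GAnd (GNot (prime_divides_form x u k)) (GEq (GVar d) GOne))))"

lemma gsat_ord_divides_form:
  "x < k \<Longrightarrow> s < k \<Longrightarrow> gsat M e (ord_divides_form x s k) \<longleftrightarrow> ord_divides M (e x) (e s)"
  by (simp add: ord_divides_form_def ord_divides_def)

lemma gsat_prime_divides_form:
  "x < k \<Longrightarrow> u < k \<Longrightarrow> gsat M e (prime_divides_form x u k) \<longleftrightarrow> prime_divides M (e x) (e u)"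
  by (simp add: prime_divides_form_def prime_divides_def gsat_ord_divides_form)

lemma gsat_coded_form:
  "x < k \<Longrightarrow> u < k \<Longrightarrow> s < k \<Longrightarrow> d < k \<Longrightarrow>
     gsat M e (coded_form x u s d k) \<longleftrightarrow> coded M (e x) (e u) (e s) (e d)"
  by (simp add: coded_form_def coded_def gsat_ord_divides_form gsat_prime_divides_form)

lemma free_vars_ord_divides_form: "free_vars (ord_divides_form x s k) \<subseteq> {x, s}"
  unfolding ord_divides_form_def by auto

lemma free_vars_prime_divides_form: "free_vars (prime_divides_form x u k) \<subseteq> {x, u}"
  unfolding prime_divides_form_def using free_vars_ord_divides_form[of x u k]
    free_vars_ord_divides_form[of k x "k + 1"] free_vars_ord_divides_form[of x k "k + 1"]
  by (simp add: subset_iff) blast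

lemma free_vars_coded_form: "free_vars (coded_form x u s d k) \<subseteq> {x, u, s, d}"
  unfolding coded_form_def
  using free_vars_prime_divides_form[of x u k] free_vars_ord_divides_form[of x s k]
  by (simp add: subset_iff) blast

section \<open>Boolean formulas evaluated on sets of patterns\<close>

primrec bterm_holds :: "(nat \<Rightarrow> bool) \<Rightarrow> bterm \<Rightarrow> bool" where
  "bterm_holds p (BVar i) \<longleftrightarrow> p i"
| "bterm_holds p BZero \<longleftrightarrow> False"
| "bterm_holds p BOne \<longleftrightarrow> True"
| "bterm_holds p (BMeet s t) \<longleftrightarrow> bterm_holds p s \<and> bterm_holds p t"
| "bterm_holds p (BJoin s t) \<longleftrightarrow> bterm_holds p s \<or> bterm_holds p t"
| "bterm_holds p (BCompl t) \<longleftrightarrow> \<not> bterm_holds p t"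

primrec pattern_sat :: "(nat \<Rightarrow> bool) set \<Rightarrow> bform \<Rightarrow> bool" where
  "pattern_sat P (BEq s t) \<longleftrightarrow> (\<forall>p\<in>P. bterm_holds p s \<longleftrightarrow> bterm_holds p t)"
| "pattern_sat P (BNot \<chi>) \<longleftrightarrow> \<not> pattern_sat P \<chi>"
| "pattern_sat P (BAnd \<chi> \<psi>) \<longleftrightarrow> pattern_sat P \<chi> \<and> pattern_sat P \<psi>"
| "pattern_sat P (BOr \<chi> \<psi>) \<longleftrightarrow> pattern_sat P \<chi> \<or> pattern_sat P \<psi>"

lemma mem_bterm_val: "a \<in> U \<Longrightarrow> a \<in> bterm_val U Z t \<longleftrightarrow> bterm_holds (\<lambda>i. a \<in> Z i) t"
  by (induction t) auto

lemma bterm_val_subset: "(\<And>i. Z i \<subseteq> U) \<Longrightarrow> bterm_val U Z t \<subseteq> U"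
  by (induction t) auto

text \<open>A point enters a Boolean formula only through the list of sets containing it. Equality
  of subsets of \<open>U\<close> is tested point by point, so the set of realised patterns decides
  \<open>\<chi>\<close>.\<close>

lemma bsat_iff_pattern_sat:
  assumes "\<And>i. Z i \<subseteq> U"
  shows "bsat U Z \<chi> \<longleftrightarrow> pattern_sat ((\<lambda>a i. a \<in> Z i) ` U) \<chi>"
proof (induction \<chi>)
  case (BEq s t)
  have "bterm_val U Z s = bterm_val U Z t \<longleftrightarrow> (\<forall>a\<in>U. a \<in> bterm_val U Z s \<longleftrightarrow> a \<in> bterm_val U Z t)"
    using bterm_val_subset[of Z U, OF assms] by blast
  then show ?case by (simp add: mem_bterm_val)
qed auto

lemma bterm_holds_cong:
  "(\<And>i. i \<in> bterm_vars t \<Longrightarrow> p i = q i) \<Longrightarrow> bterm_holds p t = bterm_holds q t"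
  by (induction t) auto

lemma pattern_sat_cong:
  assumes "bform_vars \<chi> \<subseteq> {..<n}"
    and eq: "(\<lambda>p. {i. i < n \<and> p i}) ` P = (\<lambda>p. {i. i < n \<and> p i}) ` Q"
  shows "pattern_sat P \<chi> \<longleftrightarrow> pattern_sat Q \<chi>"
  using assms(1)
proof (induction \<chi>)
  case (BEq s t)
  define cut where "cut p = {i. i < n \<and> p i}" for p
  have cut_eq: "cut ` P = cut ` Q" using eq unfolding cut_def .
  have vars: "bterm_vars s \<subseteq> {..<n}" "bterm_vars t \<subseteq> {..<n}" using BEq by simp_all
  have agree: "(bterm_holds p s \<longleftrightarrow> bterm_holds p t) \<longleftrightarrow> (bterm_holds q s \<longleftrightarrow> bterm_holds q t)"
    if "cut p = cut q" for p q
  proof -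
    have "p i = q i" if "i < n" for i using \<open>cut p = cut q\<close> that unfolding cut_def by blast
    then show ?thesis using bterm_holds_cong[of s p q] bterm_holds_cong[of t p q] vars by blast
  qed
  \<comment> \<open>Stated for arbitrary \<open>P'\<close> and \<open>Q'\<close> so that it serves
    both directions.\<close>
  have transfer: "\<forall>p\<in>P'. bterm_holds p s \<longleftrightarrow> bterm_holds p t"
    if cut: "cut ` P' = cut ` Q'" and Q': "\<forall>q\<in>Q'. bterm_holds q s \<longleftrightarrow> bterm_holds q t" for P' Q'
  proof
    fix p assume "p \<in> P'"
    then have "cut p \<in> cut ` Q'" unfolding cut[symmetric] by (rule imageI)
    then obtain q where q: "cut p = cut q" "q \<in> Q'" by (rule imageE)
    show "bterm_holds p s \<longleftrightarrow> bterm_holds p t" using agree[OF q(1)] bspec[OF Q' q(2)] by (rule iffD2)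
  qed
  show ?case
    unfolding pattern_sat.simps using transfer[OF cut_eq] transfer[OF cut_eq[symmetric]] by (rule iffI[rotated])
qed simp_all

section \<open>Boolean formulas as first-order formulas\<close>

primrec bterm_form :: "(nat \<Rightarrow> gform) \<Rightarrow> bterm \<Rightarrow> gform" where
  "bterm_form F (BVar i) = F i"
| "bterm_form F BZero = GNot (GEq GOne GOne)"
| "bterm_form F BOne = GEq GOne GOne"
| "bterm_form F (BMeet s t) = GAnd (bterm_form F s) (bterm_form F t)"
| "bterm_form F (BJoin s t) = GNot (GAnd (GNot (bterm_form F s)) (GNot (bterm_form F t)))"
| "bterm_form F (BCompl t) = GNot (bterm_form F t)"

text \<open>Variable 0 ranges over points and \<open>F i\<close> defines the \<open>i\<close>-th
  set; an equation becomes two inclusions, with the other variables of \<open>F i\<close> as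
  parameters.\<close>

primrec bform_form :: "(nat \<Rightarrow> gform) \<Rightarrow> bform \<Rightarrow> gform" where
  "bform_form F (BEq s t) = GAnd
     (GNot (GEx 0 (GAnd (bterm_form F s) (GNot (bterm_form F t)))))
     (GNot (GEx 0 (GAnd (bterm_form F t) (GNot (bterm_form F s)))))"
| "bform_form F (BNot \<chi>) = GNot (bform_form F \<chi>)"
| "bform_form F (BAnd \<chi> \<psi>) = GAnd (bform_form F \<chi>) (bform_form F \<psi>)"
| "bform_form F (BOr \<chi> \<psi>) = GNot (GAnd (GNot (bform_form F \<chi>)) (GNot (bform_form F \<psi>)))"

lemma gsat_bterm_form: "gsat M e (bterm_form F t) \<longleftrightarrow> bterm_holds (\<lambda>i. gsat M e (F i)) t"
  by (induction t) auto

lemma gsat_bform_form: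
  "gsat M e (bform_form F \<chi>) \<longleftrightarrow> pattern_sat ((\<lambda>a i. gsat M (e(0 := a)) (F i)) ` carrier M) \<chi>"
  by (induction \<chi>) (auto simp: gsat_bterm_form fun_upd_def)

lemma free_vars_bterm_form: "free_vars (bterm_form F t) \<subseteq> (\<Union>i\<in>bterm_vars t. free_vars (F i))"
  by (induction t) auto

lemma free_vars_bform_form:
  "free_vars (bform_form F \<chi>) \<subseteq> (\<Union>i\<in>bform_vars \<chi>. free_vars (F i)) - {0}"
proof (induction \<chi>)
  case (BEq s t)
  show ?case using free_vars_bterm_form[of F s] free_vars_bterm_form[of F t] by auto
qed auto

lemma free_vars_foldr_GEx: "free_vars (foldr GEx vs \<psi>) = free_vars \<psi> - set vs"
  by (induction vs) auto

lemma gsat_foldr_GEx: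
  "gsat M e (foldr GEx vs \<psi>) \<longleftrightarrow>
     (\<exists>f. (\<forall>v\<in>set vs. f v \<in> carrier M) \<and> gsat M (\<lambda>v. if v \<in> set vs then f v else e v) \<psi>)"
proof (induction vs arbitrary: e)
  case (Cons v vs)
  show ?case (is "_ \<longleftrightarrow> ?R")
  proof
    assume "gsat M e (foldr GEx (v # vs) \<psi>)"
    then obtain a f where a: "a \<in> carrier M" and f: "\<forall>w\<in>set vs. f w \<in> carrier M"
      and sat: "gsat M (\<lambda>w. if w \<in> set vs then f w else (e(v := a)) w) \<psi>"
      using Cons.IH by auto
    \<comment> \<open>If \<open>v\<close> occurs again in \<open>vs\<close>, the inner quantifier
      overrides \<open>a\<close>.\<close>
    let ?f = "\<lambda>w. if w \<in> set vs then f w else a"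
    have "(\<lambda>w. if w \<in> set vs then f w else (e(v := a)) w)
        = (\<lambda>w. if w \<in> set (v # vs) then ?f w else e w)" by auto
    then show ?R using a f sat by (intro exI[of _ ?f]) auto
  next
    assume ?R
    then obtain f where f: "\<forall>w\<in>set (v # vs). f w \<in> carrier M"
      and sat: "gsat M (\<lambda>w. if w \<in> set (v # vs) then f w else e w) \<psi>" by blast
    have "(\<lambda>w. if w \<in> set (v # vs) then f w else e w)
        = (\<lambda>w. if w \<in> set vs then f w else (e(v := f v)) w)" by auto
    then have "gsat M (e(v := f v)) (foldr GEx vs \<psi>)" unfolding Cons.IH using f sat by auto
    then show "gsat M e (foldr GEx (v # vs) \<psi>)" using f by auto
  qed
qed simp

text \<open>Existence of parameters realising \<open>\<chi>\<close>, put into one sentence to pass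
  between models. Index \<open>i\<close> owns the variables \<open>3 * i + 1\<close> to
  \<open>3 * i + 3\<close>. Bound variables from \<open>3 * i + 4\<close> on may coincide with later
  blocks, but these are not free in the \<open>i\<close>-th formula.\<close>

definition coding_sentence :: "nat \<Rightarrow> bform \<Rightarrow> gform" where
  "coding_sentence n \<chi> = foldr GEx [1..<3 * n + 1]
     (bform_form (\<lambda>i. coded_form 0 (3 * i + 1) (3 * i + 2) (3 * i + 3) (3 * i + 4)) \<chi>)"

lemma sentence_coding_sentence:
  assumes "bform_vars \<chi> \<subseteq> {..<n}"
  shows "sentence (coding_sentence n \<chi>)"
proof -
  let ?F = "\<lambda>i. coded_form 0 (3 * i + 1) (3 * i + 2) (3 * i + 3) (3 * i + 4)"
  have "free_vars (bform_form ?F \<chi>) \<subseteq> {1..<3 * n + 1}"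
  proof
    fix v assume "v \<in> free_vars (bform_form ?F \<chi>)"
    then obtain i where "i \<in> bform_vars \<chi>" "v \<in> free_vars (?F i)" "v \<noteq> 0"
      using free_vars_bform_form[of ?F \<chi>] by blast
    then have "i < n" "v \<in> {3 * i + 1, 3 * i + 2, 3 * i + 3}"
      using assms free_vars_coded_form[of 0 "3 * i + 1" "3 * i + 2" "3 * i + 3" "3 * i + 4"] by auto
    then show "v \<in> {1..<3 * n + 1}" by auto
  qed
  then show ?thesis unfolding sentence_def coding_sentence_def free_vars_foldr_GEx by auto
qed

lemma gsat_coding_sentence:
  assumes "bform_vars \<chi> \<subseteq> {..<n}"
  shows "gsat M e (coding_sentence n \<chi>) \<longleftrightarrow>
     (\<exists>u s d. (\<forall>i<n. u i \<in> carrier M \<and> s i \<in> carrier M \<and> d i \<in> carrier M) \<and>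
       pattern_sat ((\<lambda>a i. coded M a (u i) (s i) (d i)) ` carrier M) \<chi>)" (is "_ \<longleftrightarrow> ?R")
proof -
  let ?F = "\<lambda>i. coded_form 0 (3 * i + 1) (3 * i + 2) (3 * i + 3) (3 * i + 4)"
  let ?V = "{1..<3 * n + 1}"
  let ?e = "\<lambda>f v. if v \<in> ?V then f v else e v"
  have body: "gsat M e' (bform_form ?F \<chi>) \<longleftrightarrow> pattern_sat
      ((\<lambda>a i. coded M a (e' (3 * i + 1)) (e' (3 * i + 2)) (e' (3 * i + 3))) ` carrier M) \<chi>" for e'
    unfolding gsat_bform_form by (simp add: gsat_coded_form)
  have sat: "gsat M e (coding_sentence n \<chi>) \<longleftrightarrow>
      (\<exists>f. (\<forall>v\<in>?V. f v \<in> carrier M) \<and> gsat M (?e f) (bform_form ?F \<chi>))"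
    unfolding coding_sentence_def gsat_foldr_GEx set_upt ..
  show ?thesis
  proof
    assume "gsat M e (coding_sentence n \<chi>)"
    then obtain f where f: "\<forall>v\<in>?V. f v \<in> carrier M" "gsat M (?e f) (bform_form ?F \<chi>)"
      unfolding sat by blast
    show ?R
      by (rule exI[of _ "\<lambda>i. ?e f (3 * i + 1)"], rule exI[of _ "\<lambda>i. ?e f (3 * i + 2)"],
          rule exI[of _ "\<lambda>i. ?e f (3 * i + 3)"]) (use f body[of "?e f"] in simp)
  next
    assume ?R
    then obtain u s d where usd: "\<And>i. i < n \<Longrightarrow> u i \<in> carrier M \<and> s i \<in> carrier M \<and> d i \<in> carrier M"
      and ps: "pattern_sat ((\<lambda>a i. coded M a (u i) (s i) (d i)) ` carrier M) \<chi>" by blast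
    \<comment> \<open>Decodes a variable into its block and position; \<open>3 * i + 3\<close> has
      quotient \<open>i + 1\<close>, hence the subtraction.\<close>
    define f where "f v = (if v mod 3 = 1 then u (v div 3) else if v mod 3 = 2 then s (v div 3)
      else d (v div 3 - 1))" for v
    have f_simps: "f (3 * i + 1) = u i" "f (3 * i + 2) = s i" "f (3 * i + 3) = d i" for i
    proof -
      have "(3 * i + 1) mod 3 = 1" "(3 * i + 1) div 3 = i" "(3 * i + 2) mod 3 = 2" "(3 * i + 2) div 3 = i"
        "(3 * i + 3) mod 3 = 0" "(3 * i + 3) div 3 - 1 = i" by presburger+
      then show "f (3 * i + 1) = u i" "f (3 * i + 2) = s i" "f (3 * i + 3) = d i"
        unfolding f_def by simp_all
    qed
    have "f v \<in> carrier M" if "v \<in> ?V" for v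
    proof -
      have "\<exists>i<n. v = 3 * i + 1 \<or> v = 3 * i + 2 \<or> v = 3 * i + 3"
        using that by (intro exI[of _ "(v - 1) div 3"]) (simp, presburger)
      then show ?thesis using usd f_simps by metis
    qed
    \<comment> \<open>Beyond the quantified variables the assignment still follows \<open>e\<close>,
      so the patterns agree only below \<open>n\<close>, which suffices for
      \<open>\<chi>\<close>.\<close>
    moreover have "pattern_sat ((\<lambda>a i. coded M a (?e f (3 * i + 1)) (?e f (3 * i + 2)) (?e f (3 * i + 3))) ` carrier M) \<chi>
        \<longleftrightarrow> pattern_sat ((\<lambda>a i. coded M a (u i) (s i) (d i)) ` carrier M) \<chi>"
    proof (rule pattern_sat_cong[OF assms])
      have "?e f (3 * i + 1) = u i" "?e f (3 * i + 2) = s i" "?e f (3 * i + 3) = d i" if "i < n" for i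
        using that f_simps[of i] by simp_all
      then show "(\<lambda>p. {i. i < n \<and> p i}) `
          (\<lambda>a i. coded M a (?e f (3 * i + 1)) (?e f (3 * i + 2)) (?e f (3 * i + 3))) ` carrier M
        = (\<lambda>p. {i. i < n \<and> p i}) ` (\<lambda>a i. coded M a (u i) (s i) (d i)) ` carrier M"
        unfolding image_image by (intro image_cong refl Collect_cong conj_cong) simp_all
    qed
    ultimately show "gsat M e (coding_sentence n \<chi>)" unfolding sat using ps body[of "?e f"] by blast
  qed
qed

lemma bsat_def_set_coded_form:
  "bsat (tuples M 1) (\<lambda>i. def_set M 1 (coded_form 0 1 2 3 4) [u i, s i, d i]) \<chi> \<longleftrightarrow>
     pattern_sat ((\<lambda>a i. coded M a (u i) (s i) (d i)) ` carrier M) \<chi>"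
proof -
  have tup: "tuples M 1 = (\<lambda>a. [a]) ` carrier M"
    unfolding tuples_def by (auto simp: length_Suc_conv)
  have mem: "[a] \<in> def_set M 1 (coded_form 0 1 2 3 4) [u i, s i, d i] \<longleftrightarrow> coded M a (u i) (s i) (d i)"
    if "a \<in> carrier M" for a i
    using that unfolding def_set_def tup by (simp add: gsat_coded_form image_iff)
  have sub: "def_set M 1 (coded_form 0 1 2 3 4) [u i, s i, d i] \<subseteq> tuples M 1" for i
    unfolding def_set_def by (rule Collect_subset)
  have "bsat (tuples M 1) (\<lambda>i. def_set M 1 (coded_form 0 1 2 3 4) [u i, s i, d i]) \<chi> \<longleftrightarrow>
      pattern_sat ((\<lambda>as i. as \<in> def_set M 1 (coded_form 0 1 2 3 4) [u i, s i, d i]) ` tuples M 1) \<chi>"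
    by (rule bsat_iff_pattern_sat[OF sub])
  also have "(\<lambda>as i. as \<in> def_set M 1 (coded_form 0 1 2 3 4) [u i, s i, d i]) ` tuples M 1
      = (\<lambda>a i. coded M a (u i) (s i) (d i)) ` carrier M"
    unfolding tup image_image by (rule image_cong[OF refl]) (rule ext, rule mem)
  finally show ?thesis .
qed

section \<open>Realisation in the group and transfer to all models\<close>

lemma (in inner_ultrahomogeneous_group) coding_sentence_in_Th:
  assumes many: "\<And>n. \<exists>g\<in>carrier G. ord g > 0 \<and> card (prime_factors (ord g)) \<ge> n"
    and \<chi>: "bform_vars \<chi> \<subseteq> {..<n}" "bconsistent \<chi>"
  shows "coding_sentence n \<chi> \<in> Th G"
proof -
  obtain U :: "nat set" and Z where U: "U \<noteq> {}" "\<And>i. Z i \<subseteq> U" "bsat U Z \<chi>"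
    using \<chi>(2) unfolding bconsistent_def by blast
  let ?P = "(\<lambda>a i. a \<in> Z i) ` U"
  \<comment> \<open>Truncating the patterns of a witness for \<open>\<chi>\<close> to the first
    \<open>n\<close> indices makes the set finite, as \<open>exists_coding\<close> requires.\<close>
  let ?E = "(\<lambda>p. {i. i < n \<and> p i}) ` ?P"
  have "?E \<subseteq> Pow {..<n}" by (rule image_subsetI) auto
  then have fin: "finite ?E" by (rule finite_subset) simp
  have ne: "?E \<noteq> {}" using U(1) by simp
  obtain u s d where u: "u \<in> carrier G" and sd: "\<forall>i. s i \<in> carrier G \<and> d i \<in> carrier G"
    and coded: "(\<lambda>x. {i. coded G x u (s i) (d i)}) ` carrier G = ?E"
    using exists_coding[OF many fin ne] by (elim exE conjE)
  let ?Q = "(\<lambda>a i. coded G a u (s i) (d i)) ` carrier G"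
  have "(\<lambda>p. {i. i < n \<and> p i}) ` ?Q = (\<lambda>S. S \<inter> {..<n}) ` (\<lambda>x. {i. coded G x u (s i) (d i)}) ` carrier G"
    unfolding image_image by (rule image_cong[OF refl]) blast
  also have "\<dots> = ?E" unfolding coded image_image by (rule image_cong[OF refl]) blast
  finally have "pattern_sat ?Q \<chi> \<longleftrightarrow> pattern_sat ?P \<chi>" by (rule pattern_sat_cong[OF \<chi>(1)])
  then have "pattern_sat ?Q \<chi>" using U(3) bsat_iff_pattern_sat[of Z U \<chi>, OF U(2)] by blast
  then have "gsat G e (coding_sentence n \<chi>)" for e
    unfolding gsat_coding_sentence[OF \<chi>(1)] using u sd
    by (intro exI[of _ "\<lambda>_. u"] exI[of _ s] exI[of _ d]) simp
  then show ?thesis using sentence_coding_sentence[OF \<chi>(1)] unfolding Th_def holds_def by simp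
qed

theorem theorem5p26:
  fixes \<Gamma> :: "'a monoid"
  assumes "group \<Gamma>"
    and "inner_ultrahomogeneous \<Gamma>"
    and "\<And>n :: nat. \<exists>g\<in>carrier \<Gamma>. group.ord \<Gamma> g > 0 \<and> card (prime_factors (group.ord \<Gamma> g)) \<ge> n"
  shows "straightly_maximal TYPE('m) (Th \<Gamma>)"
proof -
  interpret inner_ultrahomogeneous_group \<Gamma>
    using assms(1,2) by (intro inner_ultrahomogeneous_group.intro inner_ultrahomogeneous_group_axioms.intro)
  let ?\<phi> = "coded_form 0 1 2 3 4"
  show ?thesis
    unfolding straightly_maximal_def
  proof (rule exI[of _ ?\<phi>], rule exI[of _ "1::nat"], rule exI[of _ "3::nat"], intro conjI allI impI)
    show "free_vars ?\<phi> \<subseteq> {..<1 + 3}" using free_vars_coded_form[of 0 1 2 3 4] by auto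
    fix n \<chi> and M :: "'m monoid"
    assume \<chi>: "bform_vars \<chi> \<subseteq> {..<n} \<and> bconsistent \<chi>" and M: "model_of M (Th \<Gamma>)"
    \<comment> \<open>The sentence is true in \<open>\<Gamma>\<close>, hence in \<open>M\<close>,
      and its witnesses there are the required parameters. The coding by prime orders need not
      persist in \<open>M\<close>.\<close>
    have "coding_sentence n \<chi> \<in> Th \<Gamma>" using coding_sentence_in_Th[OF assms(3)] \<chi> by blast
    then have "gsat M (\<lambda>_. undefined) (coding_sentence n \<chi>)"
      using M unfolding model_of_def holds_def by blast
    then obtain u s d where usd: "\<And>i. i < n \<Longrightarrow> u i \<in> carrier M \<and> s i \<in> carrier M \<and> d i \<in> carrier M"
      and sat: "pattern_sat ((\<lambda>a i. coded M a (u i) (s i) (d i)) ` carrier M) \<chi>"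
      using gsat_coding_sentence[of \<chi> n] \<chi> by blast
    show "\<exists>b. (\<forall>i<n. b i \<in> tuples M 3) \<and> bsat (tuples M 1) (\<lambda>i. def_set M 1 ?\<phi> (b i)) \<chi>"
    proof (intro exI[of _ "\<lambda>i. [u i, s i, d i]"] conjI)
      show "\<forall>i<n. [u i, s i, d i] \<in> tuples M 3" using usd by (simp add: tuples_def)
    qed (rule iffD2[OF bsat_def_set_coded_form sat])
  qed
qed

end
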